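(* Let $q$ be a prime power and let $G\cong \mathrm{PSp}(4,q)$. Then $\Gamma_S(G)$ is not a cograph.
   Context: For a group $G$ with identity $e$, the intersection subgroup graph $\Gamma_S(G)$ is the simple graph whose vertices are the non-trivial subgroups $H$ of $G$ such that $H\cap K=\{e\}$ for some non-trivial subgroup $K$ of $G$; two distinct vertices $H,K$ are adjacent if and only if $H\cap K=\{e\}$. A graph is a cograph if it has no induced subgraph isomorphic to the path $P_4$ on four vertices. $\mathrm{PSp}(4,q)$ is the projective symplectic group of dimension $4$ over the field with $q$ elements. *)

theory Defs
  imports
    "HOL-Analysis.Cartesian_Space"
    "HOL-Algebra.Coset"
    "HOL-Number_Theory.Prime_Powers"
    "Graph_Theory.Digraph_Isomorphism"
    "Graph_Theory.Pair_Digraph"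
begin

text \<open>
  A simple graph is represented as a \<^typ>\<open>'a pair_pre_digraph\<close> whose arc relation is
  symmetric and irreflexive: an edge between \<open>u\<close> and \<open>v\<close> is the pair of arcs \<open>(u, v)\<close>, \<open>(v, u)\<close>.
\<close>

definition path_P4 :: "nat pair_pre_digraph" where
  "path_P4 = \<lparr> pverts = {0, 1, 2, 3},
               parcs = {(0, 1), (1, 0), (1, 2), (2, 1), (2, 3), (3, 2)} \<rparr>"

definition cograph :: "'a pair_pre_digraph \<Rightarrow> bool" where
  "cograph \<Gamma> \<longleftrightarrow>
     \<not> (\<exists>\<Delta> :: 'a pair_pre_digraph.
          induced_subgraph (with_proj \<Delta>) (with_proj \<Gamma>) \<and>
          digraph_iso (with_proj \<Delta>) (with_proj path_P4))"

definition nontrivial_subgroups :: "('g, 'x) monoid_scheme \<Rightarrow> 'g set set" where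
  "nontrivial_subgroups G = {H. subgroup H G \<and> H \<noteq> {\<one>\<^bsub>G\<^esub>}}"

definition intersection_subgroup_graph :: "('g, 'x) monoid_scheme \<Rightarrow> 'g set pair_pre_digraph"
  (\<open>\<Gamma>\<^sub>S\<close>) where
  "\<Gamma>\<^sub>S G =
     (let V = {H \<in> nontrivial_subgroups G. \<exists>K \<in> nontrivial_subgroups G. H \<inter> K = {\<one>\<^bsub>G\<^esub>}}
      in \<lparr> pverts = V,
           parcs = {(H, K). H \<in> V \<and> K \<in> V \<and> H \<noteq> K \<and> H \<inter> K = {\<one>\<^bsub>G\<^esub>}} \<rparr>)"

lemma intersection_subgroup_graph_simple: "pair_bidirected_digraph (\<Gamma>\<^sub>S G)"
proof
  show "symmetric (with_proj (\<Gamma>\<^sub>S G))"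
    unfolding symmetric_def sym_def with_proj_simps
    by (simp add: intersection_subgroup_graph_def Let_def) blast
qed (auto simp only: intersection_subgroup_graph_def Let_def pair_pre_digraph.simps
    split_paired_all fst_conv snd_conv mem_Collect_eq prod.case)

definition group_center :: "('g, 'x) monoid_scheme \<Rightarrow> 'g set" where
  "group_center G = {z \<in> carrier G. \<forall>x \<in> carrier G. z \<otimes>\<^bsub>G\<^esub> x = x \<otimes>\<^bsub>G\<^esub> z}"

text \<open>
  Gram matrix of the standard nondegenerate alternating form
  \<open>x\<^sub>1 y\<^sub>3 + x\<^sub>2 y\<^sub>4 - x\<^sub>3 y\<^sub>1 - x\<^sub>4 y\<^sub>2\<close>; the diagonal vanishes, so the form is alternating in
  characteristic 2 as well.
\<close>

definition symplectic_form :: "'f::field ^ 4 ^ 4" where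
  "symplectic_form =
     vector [vector [ 0,  0, 1, 0],
             vector [ 0,  0, 0, 1],
             vector [-1,  0, 0, 0],
             vector [ 0, -1, 0, 0]]"

text \<open>
  The coefficient field of \<open>Sp4\<close> and \<open>PSp4\<close> is given by their type.
\<close>

definition Sp4 :: "('f::field ^ 4 ^ 4) monoid" where
  "Sp4 = \<lparr> carrier = {A. transpose A ** symplectic_form ** A = symplectic_form},
           monoid.mult = (**), one = mat 1 \<rparr>"

definition PSp4 :: "('f::field ^ 4 ^ 4) set monoid" where
  "PSp4 = Sp4 Mod group_center Sp4"

lemma vector_4:
  "(vector [x, y, z, w] :: 'a::zero ^ 4) $ 1 = x"
  "(vector [x, y, z, w] :: 'a::zero ^ 4) $ 2 = y"
  "(vector [x, y, z, w] :: 'a::zero ^ 4) $ 3 = z"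
  "(vector [x, y, z, w] :: 'a::zero ^ 4) $ 4 = w"
  unfolding vector_def by simp_all

lemma symplectic_form_square:
  "symplectic_form ** symplectic_form = - (mat 1 :: 'f::field ^ 4 ^ 4)"
  by (simp add: vec_eq_iff forall_4 matrix_matrix_mult_def sum_4 symplectic_form_def
      vector_4 mat_def)

lemma group_Sp4: "group (Sp4 :: ('f::field ^ 4 ^ 4) monoid)"
proof (rule groupI)
  fix A B :: "'f ^ 4 ^ 4"
  assume A: "A \<in> carrier Sp4" and B: "B \<in> carrier Sp4"
  have "transpose (A ** B) ** symplectic_form ** (A ** B)
      = transpose B ** (transpose A ** symplectic_form ** A) ** B"
    by (simp add: matrix_transpose_mul matrix_mul_assoc)
  with A B show "A \<otimes>\<^bsub>Sp4\<^esub> B \<in> carrier Sp4"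
    by (simp add: Sp4_def)
next
  fix A :: "'f ^ 4 ^ 4"
  let ?J = "symplectic_form :: 'f ^ 4 ^ 4"
  assume "A \<in> carrier Sp4"
  then have A: "transpose A ** ?J ** A = ?J"
    by (simp add: Sp4_def)
  define B where "B = - ?J ** transpose A ** ?J"
  have neg: "(- X) ** Y = - (X ** Y)" for X Y :: "'f ^ 4 ^ 4"
    by (simp add: vec_eq_iff matrix_matrix_mult_def sum_negf)
  have "B ** A = - (?J ** (transpose A ** ?J ** A))"
    by (simp add: B_def neg matrix_mul_assoc)
  also have "\<dots> = mat 1"
    by (simp add: A symplectic_form_square)
  finally have BA: "B ** A = mat 1" .
  then have AB: "A ** B = mat 1"
    using matrix_left_right_inverse by blast
  have "transpose B ** ?J ** B = transpose B ** (transpose A ** ?J ** A) ** B"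
    by (simp add: A)
  also have "\<dots> = transpose (A ** B) ** ?J ** (A ** B)"
    by (simp add: matrix_transpose_mul matrix_mul_assoc)
  also have "\<dots> = ?J"
    by (simp add: AB transpose_mat)
  finally show "\<exists>B \<in> carrier Sp4. B \<otimes>\<^bsub>Sp4\<^esub> A = \<one>\<^bsub>Sp4\<^esub>"
    using BA by (intro bexI[of _ B]) (simp_all add: Sp4_def)
qed (simp_all add: Sp4_def transpose_mat matrix_mul_assoc)

lemma group_center_normal:
  fixes G (structure)
  assumes "group G"
  shows "group_center G \<lhd> G"
proof -
  interpret group G by fact
  have inv_comm: "inv z \<otimes> x = x \<otimes> inv z"
    if z: "z \<in> carrier G" and x: "x \<in> carrier G" and comm: "z \<otimes> x = x \<otimes> z" for z x
  proof -
    have "inv z \<otimes> x = inv z \<otimes> (x \<otimes> z) \<otimes> inv z"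
      using z x by (simp add: m_assoc)
    also have "\<dots> = inv z \<otimes> (z \<otimes> x) \<otimes> inv z"
      by (rule arg_cong[OF comm[symmetric]])
    also have "\<dots> = x \<otimes> inv z"
      using z x by (simp add: m_assoc[symmetric])
    finally show ?thesis .
  qed
  have mult_comm: "a \<otimes> b \<otimes> x = x \<otimes> (a \<otimes> b)"
    if "a \<in> group_center G" "b \<in> group_center G" and x: "x \<in> carrier G" for a b x
  proof -
    have ab: "a \<in> carrier G" "b \<in> carrier G" and ax: "a \<otimes> x = x \<otimes> a" and bx: "b \<otimes> x = x \<otimes> b"
      using that unfolding group_center_def by blast+
    have "a \<otimes> b \<otimes> x = a \<otimes> (b \<otimes> x)"
      using ab x by (rule m_assoc)
    also have "\<dots> = a \<otimes> (x \<otimes> b)"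
      by (rule arg_cong[OF bx])
    also have "\<dots> = a \<otimes> x \<otimes> b"
      using ab x by (intro m_assoc[symmetric])
    also have "\<dots> = x \<otimes> a \<otimes> b"
      by (rule arg_cong[OF ax])
    also have "\<dots> = x \<otimes> (a \<otimes> b)"
      using ab x by (intro m_assoc)
    finally show ?thesis .
  qed
  have "subgroup (group_center G) G"
  proof (rule subgroup.intro)
    show "a \<otimes> b \<in> group_center G" if "a \<in> group_center G" "b \<in> group_center G" for a b
      using that mult_comm[OF that] unfolding group_center_def by blast
    show "inv a \<in> group_center G" if "a \<in> group_center G" for a
      using that inv_comm unfolding group_center_def by blast
    show "group_center G \<subseteq> carrier G" "\<one> \<in> group_center G"
      by (simp_all add: group_center_def)
  qed
  moreover have "x \<otimes> h \<otimes> inv x \<in> group_center G"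
    if x: "x \<in> carrier G" and h: "h \<in> group_center G" for x h
  proof -
    have hc: "h \<in> carrier G" and hx: "h \<otimes> x = x \<otimes> h"
      using x h unfolding group_center_def by blast+
    have "x \<otimes> h \<otimes> inv x = h \<otimes> x \<otimes> inv x"
      by (rule arg_cong[OF hx[symmetric]])
    also have "\<dots> = h \<otimes> (x \<otimes> inv x)"
      using hc x by (intro m_assoc) simp_all
    also have "\<dots> = h"
      using x hc by simp
    finally show ?thesis
      using h by simp
  qed
  ultimately show ?thesis
    by (simp add: normal_inv_iff)
qed

lemma group_PSp4: "group (PSp4 :: ('f::field ^ 4 ^ 4) set monoid)"
  unfolding PSp4_def by (intro normal.factorgroup_is_group group_center_normal group_Sp4)

end

(* The unipotent radical of the Siegel parabolic subgroup, consisting of the block matrices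
   [[1, S], [0, 1]] with S = [[a, b], [b, c]] symmetric, is an elementary abelian group
   isomorphic to (F, +)^3. It meets the centre of Sp(4, F) trivially and hence embeds into
   PSp(4, F). Its subgroups b = 0, a = c = 0, a = b = 0, c = 0, in this order, induce a path P_4. *)

theory Submission
  imports Defs
begin

text \<open>The six intersection conditions already make the four subgroups distinct vertices: each
  meets another one nontrivially, hence is nontrivial, and each meets another one trivially, hence
  has a neighbour.\<close>

lemma not_cograph_intersection_subgroup_graphI:
  assumes sub: "subgroup A G" "subgroup B G" "subgroup C G" "subgroup D G"
    and AB: "A \<inter> B = {\<one>\<^bsub>G\<^esub>}" and BC: "B \<inter> C = {\<one>\<^bsub>G\<^esub>}" and CD: "C \<inter> D = {\<one>\<^bsub>G\<^esub>}"
    and AC: "A \<inter> C \<noteq> {\<one>\<^bsub>G\<^esub>}" and AD: "A \<inter> D \<noteq> {\<one>\<^bsub>G\<^esub>}" and BD: "B \<inter> D \<noteq> {\<one>\<^bsub>G\<^esub>}"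
  shows "\<not> cograph (\<Gamma>\<^sub>S G)"
proof -
  have one: "\<one>\<^bsub>G\<^esub> \<in> A" "\<one>\<^bsub>G\<^esub> \<in> B" "\<one>\<^bsub>G\<^esub> \<in> C" "\<one>\<^bsub>G\<^esub> \<in> D"
    using sub by (auto dest: subgroup.one_closed)
  have ne: "A \<noteq> {\<one>\<^bsub>G\<^esub>}" "B \<noteq> {\<one>\<^bsub>G\<^esub>}" "C \<noteq> {\<one>\<^bsub>G\<^esub>}" "D \<noteq> {\<one>\<^bsub>G\<^esub>}"
    using one AC AD BD by blast+
  have rev: "B \<inter> A = {\<one>\<^bsub>G\<^esub>}" "C \<inter> B = {\<one>\<^bsub>G\<^esub>}" "D \<inter> C = {\<one>\<^bsub>G\<^esub>}"
    "C \<inter> A \<noteq> {\<one>\<^bsub>G\<^esub>}" "D \<inter> A \<noteq> {\<one>\<^bsub>G\<^esub>}" "D \<inter> B \<noteq> {\<one>\<^bsub>G\<^esub>}"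
    using AB BC CD AC AD BD by (simp_all add: Int_commute)
  \<comment> \<open>Two equal subgroups with trivial intersection would be trivial. The other pairs
    are separated by a third subgroup that meets exactly one of the two trivially: \<open>D\<close>
    for \<open>A\<close>, \<open>C\<close>; \<open>B\<close> for \<open>A\<close>, \<open>D\<close>;
    \<open>A\<close> for \<open>B\<close>, \<open>D\<close>.\<close>
  have dist: "A \<noteq> B" "A \<noteq> C" "A \<noteq> D" "B \<noteq> C" "B \<noteq> D" "C \<noteq> D"
    using AB BC CD AD BD rev(1) ne(1-3) by force+
  have nontriv: "{A, B, C, D} \<subseteq> nontrivial_subgroups G"
    using sub ne by (auto simp: nontrivial_subgroups_def)
  have verts: "{A, B, C, D} \<subseteq> pverts (\<Gamma>\<^sub>S G)"
    using nontriv AB BC CD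
    by (simp add: intersection_subgroup_graph_def Let_def) (metis Int_commute)
  have arcs: "(H, K) \<in> parcs (\<Gamma>\<^sub>S G) \<longleftrightarrow> H \<noteq> K \<and> H \<inter> K = {\<one>\<^bsub>G\<^esub>}"
    if "H \<in> {A, B, C, D}" "K \<in> {A, B, C, D}" for H K
  proof -
    have "H \<in> pverts (\<Gamma>\<^sub>S G)" "K \<in> pverts (\<Gamma>\<^sub>S G)"
      using that verts by blast+
    then show ?thesis
      by (simp add: intersection_subgroup_graph_def Let_def)
  qed
  define \<Delta> where "\<Delta> = \<lparr>pverts = {A, B, C, D},
    parcs = {(A, B), (B, A), (B, C), (C, B), (C, D), (D, C)}\<rparr>"
  have pverts_\<Delta>: "pverts \<Delta> = {A, B, C, D}"
    by (simp add: \<Delta>_def)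
  \<comment> \<open>The path must be induced, so arcs are compared in both directions over all
    sixteen pairs; \<open>AC\<close>, \<open>AD\<close> and \<open>BD\<close> rule out the
    chords.\<close>
  have "(H, K) \<in> parcs \<Delta> \<longleftrightarrow> (H, K) \<in> parcs (\<Gamma>\<^sub>S G)"
    if "H \<in> pverts \<Delta>" "K \<in> pverts \<Delta>" for H K
    unfolding arcs[OF that[unfolded pverts_\<Delta>]] using that[unfolded pverts_\<Delta>]
    by (elim insertE emptyE)
       (simp_all add: \<Delta>_def dist dist[symmetric] AB BC CD AC AD BD rev)
  moreover have "parcs \<Delta> \<subseteq> pverts \<Delta> \<times> pverts \<Delta>"
    by (simp add: \<Delta>_def)
  ultimately have parcs_\<Delta>: "parcs \<Delta> = {e \<in> parcs (\<Gamma>\<^sub>S G). fst e \<in> pverts \<Delta> \<and> snd e \<in> pverts \<Delta>}"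
    by auto
  have wf: "wf_digraph (with_proj \<Delta>)" "wf_digraph (with_proj (\<Gamma>\<^sub>S G))"
    by (auto simp: wf_digraph_def \<Delta>_def intersection_subgroup_graph_def Let_def)
  have "induced_subgraph (with_proj \<Delta>) (with_proj (\<Gamma>\<^sub>S G))"
    using verts parcs_\<Delta> wf
    by (auto simp: induced_subgraph_def subgraph_def \<Delta>_def)
  moreover have "digraph_iso (with_proj \<Delta>) (with_proj path_P4)"
    unfolding digraph_iso_def
  proof (intro exI conjI)
    \<comment> \<open>The final \<open>else\<close> branch is meant for \<open>D\<close>. It also
      sends every other set to 3, which is harmless since injectivity is required only on the
      vertices of \<open>\<Delta>\<close>.\<close>
    let ?f = "\<lambda>H. if H = A then 0 else if H = B then 1 else if H = C then 2 else 3 :: nat"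
    \<comment> \<open>Arcs are ordered pairs, so \<open>?f\<close> acts on both components; the
      projections \<open>snd\<close> and \<open>fst\<close> are the head and tail maps of
      \<open>path_P4\<close>, as equality of whole digraphs demands.\<close>
    let ?h = "\<lparr>iso_verts = ?f, iso_arcs = map_prod ?f ?f, iso_head = snd, iso_tail = fst\<rparr>"
    have "inj_on ?f {A, B, C, D}"
      using dist by (auto simp: inj_on_def)
    moreover have "inj_on (map_prod ?f ?f) (parcs \<Delta>)"
      using dist by (auto simp: inj_on_def \<Delta>_def)
    ultimately show "pre_digraph.digraph_isomorphism (with_proj \<Delta>) ?h"
      using wf by (auto simp: pre_digraph.digraph_isomorphism_def \<Delta>_def)
    show "with_proj path_P4 = app_iso ?h (with_proj \<Delta>)"
      using dist by (auto simp: app_iso_def with_proj_def path_P4_def \<Delta>_def)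
  qed
  ultimately show ?thesis
    by (auto simp: cograph_def)
qed

text \<open>Injective homomorphisms preserve subgroups and commute with intersections. Hence it
  suffices to find the configuration in any group that embeds into \<open>G\<close>.\<close>

lemma not_cograph_intersection_subgroup_graph_mon:
  assumes "group K" "group G" and h: "h \<in> mon K G"
    and sub: "subgroup A K" "subgroup B K" "subgroup C K" "subgroup D K"
    and "A \<inter> B = {\<one>\<^bsub>K\<^esub>}" "B \<inter> C = {\<one>\<^bsub>K\<^esub>}" "C \<inter> D = {\<one>\<^bsub>K\<^esub>}"
    and "A \<inter> C \<noteq> {\<one>\<^bsub>K\<^esub>}" "A \<inter> D \<noteq> {\<one>\<^bsub>K\<^esub>}" "B \<inter> D \<noteq> {\<one>\<^bsub>K\<^esub>}"
  shows "\<not> cograph (\<Gamma>\<^sub>S G)"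
proof -
  have hom: "h \<in> hom K G" and inj: "inj_on h (carrier K)"
    using h by (auto simp: mon_def)
  have gh: "group_hom K G h"
    using assms(1,2) hom by (simp add: group_hom_def group_hom_axioms_def)
  have Int: "h ` X \<inter> h ` Y = {\<one>\<^bsub>G\<^esub>} \<longleftrightarrow> X \<inter> Y = {\<one>\<^bsub>K\<^esub>}" if "subgroup X K" "subgroup Y K" for X Y
  proof -
    have sub: "X \<subseteq> carrier K" "Y \<subseteq> carrier K"
      using that by (auto dest: subgroup.subset)
    have "h ` X \<inter> h ` Y = {\<one>\<^bsub>G\<^esub>} \<longleftrightarrow> h ` (X \<inter> Y) = h ` {\<one>\<^bsub>K\<^esub>}"
      using inj_on_image_Int[OF inj sub] group_hom.hom_one[OF gh] by simp
    also have "\<dots> \<longleftrightarrow> X \<inter> Y = {\<one>\<^bsub>K\<^esub>}"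
      using sub group.is_monoid[OF assms(1)]
      by (intro inj_on_image_eq_iff[OF inj]) (auto intro: monoid.one_closed)
    finally show ?thesis .
  qed
  show ?thesis
    using assms(8-) sub
    by (intro not_cograph_intersection_subgroup_graphI[of "h ` A" G "h ` B" "h ` C" "h ` D"])
       (simp_all add: Int group_hom.subgroup_img_is_subgroup[OF gh])
qed

definition additive_group :: "'a::ab_group_add monoid" where
  "additive_group = \<lparr>carrier = UNIV, monoid.mult = (+), one = 0\<rparr>"

lemma additive_group_simps [simp]:
  "carrier additive_group = UNIV" "x \<otimes>\<^bsub>additive_group\<^esub> y = x + y" "\<one>\<^bsub>additive_group\<^esub> = 0"
  by (simp_all add: additive_group_def)

lemma group_additive_group: "group (additive_group :: 'a::ab_group_add monoid)"
proof (rule groupI)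
  show "\<exists>y \<in> carrier additive_group. y \<otimes>\<^bsub>additive_group\<^esub> x = \<one>\<^bsub>additive_group\<^esub>" for x :: 'a
    by (auto intro: exI[of _ "- x"])
qed (simp_all add: add.assoc)

lemma subgroup_additive_groupI:
  assumes "0 \<in> U" "\<And>x y. x \<in> U \<Longrightarrow> y \<in> U \<Longrightarrow> x + y \<in> U" "\<And>x. x \<in> U \<Longrightarrow> - x \<in> U"
  shows "subgroup U additive_group"
proof -
  have "inv\<^bsub>additive_group\<^esub> x = - x" for x :: 'a
    by (rule group.inv_equality[OF group_additive_group]) simp_all
  with assms show ?thesis
    by (intro group.subgroupI[OF group_additive_group]) auto
qed

text \<open>The kernel of \<open>h\<close> followed by the projection to \<open>G Mod N\<close> is
  the preimage of \<open>N\<close> under \<open>h\<close>, which \<open>triv\<close> makes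
  trivial.\<close>

lemma mon_FactGroup:
  assumes "N \<lhd> G" and "group K" and h: "h \<in> hom K G"
    and triv: "\<And>x. x \<in> carrier K \<Longrightarrow> h x \<in> N \<Longrightarrow> x = \<one>\<^bsub>K\<^esub>"
  shows "(\<lambda>x. N #>\<^bsub>G\<^esub> h x) \<in> mon K (G Mod N)"
proof -
  have G: "group G" and N: "subgroup N G"
    using assms(1) by (auto dest: normal.axioms normal_imp_subgroup)
  have hc: "h x \<in> carrier G" if "x \<in> carrier K" for x
    using h that by (auto simp: hom_def)
  have hom: "(\<lambda>x. N #>\<^bsub>G\<^esub> h x) \<in> hom K (G Mod N)"
    using h hc group.rcosetsI[OF G subgroup.subset[OF N]]
    by (auto simp: hom_def FactGroup_def normal.rcos_sum[OF assms(1)])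
  then have gh: "group_hom K (G Mod N) (\<lambda>x. N #>\<^bsub>G\<^esub> h x)"
    using assms(2) normal.factorgroup_is_group[OF assms(1)]
    by (simp add: group_hom_def group_hom_axioms_def)
  \<comment> \<open>The unit of \<open>G Mod N\<close> is \<open>N\<close> itself, and a coset equal
    to \<open>N\<close> has its representative in \<open>N\<close>.\<close>
  have "x = \<one>\<^bsub>K\<^esub>" if "x \<in> carrier K" "N #>\<^bsub>G\<^esub> h x = \<one>\<^bsub>G Mod N\<^esub>" for x
    using that triv group.coset_join1[OF G _ hc N] by auto
  then have "inj_on (\<lambda>x. N #>\<^bsub>G\<^esub> h x) (carrier K)"
    by (simp add: group_hom.inj_on_one_iff[OF gh])
  with hom show ?thesis
    by (simp add: mon_def)
qed

definition siegel_unipotent :: "'f::field \<times> 'f \<times> 'f \<Rightarrow> 'f ^ 4 ^ 4" where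
  "siegel_unipotent = (\<lambda>(a, b, c).
     vector [vector [1, 0, a, b],
             vector [0, 1, b, c],
             vector [0, 0, 1, 0],
             vector [0, 0, 0, 1]])"

text \<open>Multiplying two such block matrices adds their blocks S. The form is preserved because S
  is symmetric: the only block that could change is the lower right one, and it becomes the
  difference of the transpose of S and S.\<close>

lemma siegel_unipotent_hom: "siegel_unipotent \<in> hom additive_group Sp4"
proof (rule homI)
  show "siegel_unipotent x \<in> carrier Sp4" for x :: "'a \<times> 'a \<times> 'a"
    by (cases x) (simp add: Sp4_def siegel_unipotent_def vec_eq_iff forall_4 sum_4 vector_4
        matrix_matrix_mult_def transpose_def symplectic_form_def)
  show "siegel_unipotent (x \<otimes>\<^bsub>additive_group\<^esub> y) = siegel_unipotent x \<otimes>\<^bsub>Sp4\<^esub> siegel_unipotent y"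
    for x y :: "'a \<times> 'a \<times> 'a"
    by (cases x; cases y) (simp add: Sp4_def siegel_unipotent_def vec_eq_iff forall_4 sum_4 vector_4
        matrix_matrix_mult_def add.commute)
qed

text \<open>A single test element J, the Gram matrix \<open>symplectic_form\<close>, suffices. With
  u the block matrix, the upper left block of the product u J is -S and that of J u is 0, so
  commuting forces S = 0 in every characteristic.\<close>

lemma siegel_unipotent_center:
  assumes "siegel_unipotent x \<in> group_center Sp4"
  shows "x = 0"
proof -
  \<comment> \<open>J preserves its own form, since its transpose is -J and its square is
    -1.\<close>
  have "symplectic_form \<in> (carrier Sp4 :: ('a ^ 4 ^ 4) set)"
    by (simp add: Sp4_def vec_eq_iff forall_4 sum_4 vector_4
        matrix_matrix_mult_def transpose_def symplectic_form_def)
  then have "siegel_unipotent x ** symplectic_form = symplectic_form ** siegel_unipotent x"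
    using assms by (simp add: group_center_def Sp4_def)
  then show ?thesis
    by (cases x) (simp add: siegel_unipotent_def vec_eq_iff forall_4 sum_4 vector_4
        matrix_matrix_mult_def symplectic_form_def zero_prod_def)
qed

theorem theorem8p5:
  fixes q :: nat
    and G :: "('g, 'x) monoid_scheme"
  assumes "primepow q"
    and "CARD('f::{field, finite}) = q"
    and "group G"
    and "G \<cong> (PSp4 :: ('f ^ 4 ^ 4) set monoid)"
  shows "\<not> cograph (\<Gamma>\<^sub>S G)"
proof -
  have "(\<lambda>x. group_center Sp4 #>\<^bsub>Sp4\<^esub> siegel_unipotent x)
      \<in> mon additive_group (PSp4 :: ('f ^ 4 ^ 4) set monoid)"
    unfolding PSp4_def
    by (rule mon_FactGroup)
       (simp_all add: group_center_normal group_Sp4 group_additive_group siegel_unipotent_hom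
         siegel_unipotent_center)
  \<comment> \<open>The given isomorphism starts at \<open>G\<close>; its inverse direction is what
    carries the embedding into \<open>G\<close>.\<close>
  moreover obtain i where "i \<in> iso (PSp4 :: ('f ^ 4 ^ 4) set monoid) G"
    using group.iso_sym[OF assms(3,4)] by (auto simp: is_iso_def)
  then have "i \<in> mon (PSp4 :: ('f ^ 4 ^ 4) set monoid) G"
    by (simp add: iso_iff mon_def)
  ultimately obtain h :: "'f \<times> 'f \<times> 'f \<Rightarrow> 'g" where h: "h \<in> mon additive_group G"
    using mon_compose by blast
  show ?thesis
  proof (rule not_cograph_intersection_subgroup_graph_mon[OF group_additive_group assms(3) h])
    \<comment> \<open>In the 3-dimensional coordinate space, the first and last sets are distinct
      planes, which share a line. The second is a line in the last plane but not in the first, and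
      the third is a line in the first plane but not in the last.\<close>
    show "subgroup {(a, b, c). b = 0} (additive_group :: ('f \<times> 'f \<times> 'f) monoid)"
      "subgroup {(a, b, c). a = 0 \<and> c = 0} (additive_group :: ('f \<times> 'f \<times> 'f) monoid)"
      "subgroup {(a, b, c). a = 0 \<and> b = 0} (additive_group :: ('f \<times> 'f \<times> 'f) monoid)"
      "subgroup {(a, b, c). c = 0} (additive_group :: ('f \<times> 'f \<times> 'f) monoid)"
      by (auto intro!: subgroup_additive_groupI simp: zero_prod_def)
    \<comment> \<open>Nonzero witnesses for the three nontrivial intersections, in the order in
      which these are shown below.\<close>
    have "(0, 0, 1) \<noteq> (0 :: 'f \<times> 'f \<times> 'f)" "(1, 0, 0) \<noteq> (0 :: 'f \<times> 'f \<times> 'f)"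
      "(0, 1, 0) \<noteq> (0 :: 'f \<times> 'f \<times> 'f)"
      by (simp_all add: zero_prod_def)
    then show "{(a, b, c). b = 0} \<inter> {(a, b, c). a = 0 \<and> b = 0} \<noteq> {\<one>\<^bsub>additive_group :: ('f \<times> 'f \<times> 'f) monoid\<^esub>}"
      "{(a, b, c). b = 0} \<inter> {(a, b, c). c = 0} \<noteq> {\<one>\<^bsub>additive_group :: ('f \<times> 'f \<times> 'f) monoid\<^esub>}"
      "{(a, b, c). a = 0 \<and> c = 0} \<inter> {(a, b, c). c = 0} \<noteq> {\<one>\<^bsub>additive_group :: ('f \<times> 'f \<times> 'f) monoid\<^esub>}"
      unfolding additive_group_simps by blast+
  qed (auto simp: zero_prod_def)
qed

end
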